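(* The game $\overline{1}=\{\cdot\mid 0\}$ is prime in the monoid $\mathcal{L}$ of Left dead ends: for all Left dead ends $H,K$, if there is a Left dead end $G$ with $\overline{1}+G=H+K$, then there is a Left dead end $X$ with $H=\overline{1}+X$ or $K=\overline{1}+X$.
   Context: All games are short partizan combinatorial game forms; $G+H$ is the disjunctive sum; $0=\{\cdot\mid\cdot\}$. Play is misère (a player unable to move wins). Misère outcome classes are ordered $\mathscr L>\mathscr P>\mathscr R$ and $\mathscr L>\mathscr N>\mathscr R$; $G\geq H$ means that for every game $X$ the misère outcome of $G+X$ is $\geq$ that of $H+X$, and $G=H$ means $G\ge H$ and $H\ge G$. A Left dead end is a game no subposition of which (including itself) has a Left option. The Left dead ends, up to equality, form a commutative monoid $\mathcal{L}$ under $+$. *)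

theory Defs
  imports Main "HOL-Library.FSet"
begin

section \<open>Short partizan game forms\<close>

text \<open>The option sets are finite and the datatype is inductive, so every value is a short game
  form.  HOL equality on this type is identity of forms; equality of misere games is
  \<open>misere_eq\<close> below.\<close>

datatype game = Game (left_opts: "game fset") (right_opts: "game fset")

datatype player = Left | Right

fun opponent :: "player \<Rightarrow> player" where
  "opponent Left = Right"
| "opponent Right = Left"

fun options :: "player \<Rightarrow> game \<Rightarrow> game fset" where
  "options Left G = left_opts G"
| "options Right G = right_opts G"

lemma size_less_size_fset: "x |\<in>| A \<Longrightarrow> f x < size_fset f A"
proof -
  assume "x |\<in>| A"
  then have "Suc (f x) \<le> (\<Sum>y\<in>fset A. Suc (f y))"
    by (intro member_le_sum) auto
  then show ?thesis by simp
qed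

lemma size_left_option [termination_simp]: "G' |\<in>| left_opts G \<Longrightarrow> size G' < size G"
  by (cases G) (use size_less_size_fset[of G' "left_opts G" size] in simp)

lemma size_right_option [termination_simp]: "G' |\<in>| right_opts G \<Longrightarrow> size G' < size G"
  by (cases G) (use size_less_size_fset[of G' "right_opts G" size] in simp)

lemma size_option [termination_simp]: "G' |\<in>| options p G \<Longrightarrow> size G' < size G"
  by (cases p) (auto simp: size_left_option size_right_option)

instantiation game :: zero
begin

definition zero_game :: game where
  "0 = Game {||} {||}"

instance ..

end

definition bar_one :: game where
  "bar_one = Game {||} {|0|}"


section \<open>Disjunctive sum\<close>

function game_sum :: "game \<Rightarrow> game \<Rightarrow> game" where
  "game_sum G H = Game
     ((\<lambda>G'. game_sum G' H) |`| left_opts G |\<union>| (\<lambda>H'. game_sum G H') |`| left_opts H)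
     ((\<lambda>G'. game_sum G' H) |`| right_opts G |\<union>| (\<lambda>H'. game_sum G H') |`| right_opts H)"
  by pat_completeness auto
termination
  by (relation "measure (\<lambda>(G, H). size G + size H)")
     (auto simp: size_left_option size_right_option)

declare game_sum.simps [simp del]

instantiation game :: plus
begin

definition plus_game :: "game \<Rightarrow> game \<Rightarrow> game" where
  "G + H = game_sum G H"

instance ..

end

lemma left_opts_plus:
  "left_opts (G + H) = (\<lambda>G'. G' + H) |`| left_opts G |\<union>| (\<lambda>H'. G + H') |`| left_opts H"
  unfolding plus_game_def by (subst game_sum.simps) simp

lemma right_opts_plus:
  "right_opts (G + H) = (\<lambda>G'. G' + H) |`| right_opts G |\<union>| (\<lambda>H'. G + H') |`| right_opts H"
  unfolding plus_game_def by (subst game_sum.simps) simp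


section \<open>Misere outcomes\<close>

text \<open>\<open>wins_first p G\<close>: player \<open>p\<close>, moving first on \<open>G\<close>, wins under misere play.\<close>

function wins_first :: "player \<Rightarrow> game \<Rightarrow> bool" where
  "wins_first p G \<longleftrightarrow>
     options p G = {||} \<or> fBex (options p G) (\<lambda>G'. \<not> wins_first (opponent p) G')"
  by pat_completeness auto
termination
  by (relation "measure (\<lambda>(p, G). size G)") (auto simp: size_option)

declare wins_first.simps [simp del]

datatype outcome = OutL | OutN | OutP | OutR

definition misere_outcome :: "game \<Rightarrow> outcome" where
  "misere_outcome G =
     (if wins_first Left G
      then (if wins_first Right G then OutN else OutL)
      else (if wins_first Right G then OutR else OutP))"

instantiation outcome :: order
begin

definition less_eq_outcome :: "outcome \<Rightarrow> outcome \<Rightarrow> bool" where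
  "x \<le> y \<longleftrightarrow> x = y \<or> x = OutR \<or> y = OutL"

definition less_outcome :: "outcome \<Rightarrow> outcome \<Rightarrow> bool" where
  "x < y \<longleftrightarrow> x \<le> y \<and> \<not> y \<le> (x :: outcome)"

instance
  by standard (auto simp: less_eq_outcome_def less_outcome_def)

end

definition misere_ge :: "game \<Rightarrow> game \<Rightarrow> bool" where
  "misere_ge G H \<longleftrightarrow> (\<forall>X. misere_outcome (G + X) \<ge> misere_outcome (H + X))"

definition misere_eq :: "game \<Rightarrow> game \<Rightarrow> bool"  (infix "=\<^sub>m" 50) where
  "G =\<^sub>m H \<longleftrightarrow> misere_ge G H \<and> misere_ge H G"


section \<open>Left dead ends\<close>

inductive subposition :: "game \<Rightarrow> game \<Rightarrow> bool" where
  subposition_refl: "subposition G G"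
| subposition_option: "subposition S G' \<Longrightarrow> G' |\<in>| options p G \<Longrightarrow> subposition S G"

definition left_dead_end :: "game \<Rightarrow> bool" where
  "left_dead_end G \<longleftrightarrow> (\<forall>S. subposition S G \<longrightarrow> left_opts S = {||})"

end

theory Submission
  imports Defs
begin

text \<open>
  For Left dead ends, \<open>G \<ge> H\<close> holds iff \<open>G\<close> and \<open>H\<close> are both zero or both nonzero and
  every Right option of \<open>G\<close> is \<open>\<ge>\<close> some Right option of \<open>H\<close>.  Since Right loses nothing
  by playing the summand \<open>bar_one\<close> first, \<open>bar_one + X\<close> equals the game whose only option is \<open>X\<close>;
  so a Left dead end is divisible by \<open>bar_one\<close> iff its Right options have a least element.
  If \<open>bar_one + G = H + K\<close>, the options of \<open>H + K\<close> have a least element, say \<open>H' + K\<close>, and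
  cancelling \<open>K\<close> shows that \<open>H'\<close> is least among the options of \<open>H\<close>.
\<close>

section \<open>Sums and outcomes\<close>

lemma game_eqI: "left_opts G = left_opts H \<Longrightarrow> right_opts G = right_opts H \<Longrightarrow> G = (H :: game)"
  by (cases G; cases H) auto

lemma left_opts_zero [simp]: "left_opts 0 = {||}"
  and right_opts_zero [simp]: "right_opts 0 = {||}"
  by (simp_all add: zero_game_def)

lemma left_opts_bar_one [simp]: "left_opts bar_one = {||}"
  and right_opts_bar_one [simp]: "right_opts bar_one = {|0|}"
  by (simp_all add: bar_one_def)

lemma zero_plus_game [simp]: "0 + G = (G :: game)"
proof (induction "size G" arbitrary: G rule: less_induct)
  case less
  have "(\<lambda>G'. 0 + G') |`| left_opts G = id |`| left_opts G"
    by (rule fset.map_cong0) (simp add: less size_left_option)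
  moreover have "(\<lambda>G'. 0 + G') |`| right_opts G = id |`| right_opts G"
    by (rule fset.map_cong0) (simp add: less size_right_option)
  ultimately show ?case
    by (intro game_eqI) (simp_all add: left_opts_plus right_opts_plus)
qed

lemma game_plus_commute: "G + H = H + (G :: game)"
proof (induction "size G + size H" arbitrary: G H rule: less_induct)
  case less
  have "(\<lambda>G'. G' + H) |`| left_opts G = (\<lambda>G'. H + G') |`| left_opts G"
    "(\<lambda>H'. G + H') |`| left_opts H = (\<lambda>H'. H' + G) |`| left_opts H"
    by (rule fset.map_cong0, simp add: less size_left_option)+
  moreover have "(\<lambda>G'. G' + H) |`| right_opts G = (\<lambda>G'. H + G') |`| right_opts G"
    "(\<lambda>H'. G + H') |`| right_opts H = (\<lambda>H'. H' + G) |`| right_opts H"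
    by (rule fset.map_cong0, simp add: less size_right_option)+
  ultimately show ?case
    by (intro game_eqI) (auto simp add: left_opts_plus right_opts_plus)
qed

lemma wins_first_Left:
  "wins_first Left G \<longleftrightarrow>
     left_opts G = {||} \<or> (\<exists>G'. G' |\<in>| left_opts G \<and> \<not> wins_first Right G')"
  by (subst wins_first.simps) auto

lemma wins_first_Right:
  "wins_first Right G \<longleftrightarrow>
     right_opts G = {||} \<or> (\<exists>G'. G' |\<in>| right_opts G \<and> \<not> wins_first Left G')"
  by (subst wins_first.simps) auto

lemma misere_ge_iff_wins_first:
  "misere_ge G H \<longleftrightarrow>
     (\<forall>X. (wins_first Right (G + X) \<longrightarrow> wins_first Right (H + X)) \<and>
          (wins_first Left (H + X) \<longrightarrow> wins_first Left (G + X)))"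
proof -
  have "misere_outcome A \<ge> misere_outcome B \<longleftrightarrow>
     (wins_first Right A \<longrightarrow> wins_first Right B) \<and> (wins_first Left B \<longrightarrow> wins_first Left A)" for A B
    by (simp add: misere_outcome_def less_eq_outcome_def)
  then show ?thesis by (simp add: misere_ge_def)
qed

lemma misere_ge_refl: "misere_ge G G"
  by (simp add: misere_ge_def)

lemma misere_ge_trans: "misere_ge G H \<Longrightarrow> misere_ge H K \<Longrightarrow> misere_ge G K"
  unfolding misere_ge_def using order_trans by blast

section \<open>Left dead ends\<close>

lemma left_dead_end_iff:
  "left_dead_end G \<longleftrightarrow> left_opts G = {||} \<and> (\<forall>G'. G' |\<in>| right_opts G \<longrightarrow> left_dead_end G')"
proof
  assume G: "left_dead_end G"
  then have "left_opts G = {||}"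
    unfolding left_dead_end_def by (blast intro: subposition_refl)
  moreover have "left_dead_end G'" if "G' |\<in>| right_opts G" for G'
    using G that unfolding left_dead_end_def
    by (metis options.simps(2) subposition_option)
  ultimately show "left_opts G = {||} \<and> (\<forall>G'. G' |\<in>| right_opts G \<longrightarrow> left_dead_end G')"
    by blast
next
  assume G: "left_opts G = {||} \<and> (\<forall>G'. G' |\<in>| right_opts G \<longrightarrow> left_dead_end G')"
  show "left_dead_end G"
    unfolding left_dead_end_def
  proof (intro allI impI)
    fix S assume "subposition S G"
    then show "left_opts S = {||}"
    proof cases
      case (subposition_option G' p)
      with G show ?thesis by (cases p) (auto simp: left_dead_end_def)
    qed (use G in simp)
  qed
qed

lemma left_dead_end_left_opts: "left_dead_end G \<Longrightarrow> left_opts G = {||}"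
  using left_dead_end_iff by blast

lemma left_dead_end_right_option:
  "left_dead_end G \<Longrightarrow> G' |\<in>| right_opts G \<Longrightarrow> left_dead_end G'"
  using left_dead_end_iff by blast

lemma left_dead_end_zero: "left_dead_end 0"
  by (subst left_dead_end_iff) simp

lemma left_dead_end_bar_one: "left_dead_end bar_one"
  by (subst left_dead_end_iff) (simp add: left_dead_end_zero)

lemma left_dead_end_plus: "left_dead_end G \<Longrightarrow> left_dead_end H \<Longrightarrow> left_dead_end (G + H)"
proof (induction "size G + size H" arbitrary: G H rule: less_induct)
  case less
  have "left_dead_end G'" if "G' |\<in>| right_opts (G + H)" for G'
    using that less.prems less.hyps
    by (auto simp: right_opts_plus size_right_option left_dead_end_right_option)
  then show ?case
    using less.prems
    by (subst left_dead_end_iff) (auto simp: left_opts_plus left_dead_end_left_opts)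
qed

lemma wins_first_Left_dead_end: "left_dead_end G \<Longrightarrow> wins_first Left G"
  by (simp add: wins_first_Left left_dead_end_left_opts)

text \<open>The summand \<open>bar_one\<close> forces Right to move, and every move leaves a Left
  dead end, where Left cannot move and so wins. Test games below use \<open>bar_one\<close> as a
  rescue for Left.\<close>

lemma not_wins_first_Right_plus_bar_one: "left_dead_end G \<Longrightarrow> \<not> wins_first Right (G + bar_one)"
  using left_dead_end_plus[OF _ left_dead_end_bar_one, of G]
    wins_first_Left_dead_end left_dead_end_right_option
  by (subst wins_first_Right) (auto simp: right_opts_plus)

section \<open>The order on Left dead ends\<close>

text \<open>The integer \<open>n\<close>: a supply of \<open>n\<close> moves that only Left can
  use.\<close>

fun left_int :: "nat \<Rightarrow> game" where
  "left_int 0 = 0"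
| "left_int (Suc n) = Game {|left_int n|} {||}"

lemma right_opts_left_int [simp]: "right_opts (left_int n) = {||}"
  by (cases n) simp_all

text \<open>Left can only count down the integer while Right plays down \<open>G\<close>. A run of
  Right moves in \<open>G\<close> is no longer than \<open>size G\<close>, so Right is the first who
  cannot move.\<close>

lemma wins_first_Right_plus_left_int:
  "left_dead_end G \<Longrightarrow> size G \<le> n \<Longrightarrow> wins_first Right (G + left_int n)"
proof (induction n arbitrary: G)
  case 0
  then have "right_opts G = {||}"
    using size_right_option by fastforce
  then show ?case by (simp add: wins_first_Right right_opts_plus)
next
  case (Suc n)
  show ?case
  proof (cases "right_opts G = {||}")
    case True
    then show ?thesis by (subst wins_first_Right) (simp add: right_opts_plus)
  next
    case False
    then obtain G' where G': "G' |\<in>| right_opts G" by blast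
    then have d: "left_dead_end G'" and "size G' \<le> n"
      using Suc.prems left_dead_end_right_option size_right_option[OF G'] by auto
    then have "wins_first Right (G' + left_int n)"
      by (rule Suc.IH)
    then have "\<not> wins_first Left (G' + left_int (Suc n))"
      by (subst wins_first_Left) (simp add: left_opts_plus left_dead_end_left_opts[OF d])
    then show ?thesis
      using G' by (subst wins_first_Right) (auto simp: right_opts_plus)
  qed
qed

text \<open>Right copies a winning first move: inside \<open>X\<close> by induction, from
  \<open>G\<close> to \<open>G'\<close> by the option from \<open>opt\<close>. The condition
  \<open>zero\<close> settles the case in which Right cannot move. Left only ever moves in
  \<open>X\<close>.\<close>

lemma misere_ge_left_endI:
  assumes "left_opts G = {||}" "left_opts H = {||}"
    and zero: "right_opts G = {||} \<longleftrightarrow> right_opts H = {||}"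
    and opt: "\<And>G'. G' |\<in>| right_opts G \<Longrightarrow> \<exists>H'. H' |\<in>| right_opts H \<and> misere_ge G' H'"
  shows "misere_ge G H"
proof -
  have "(wins_first Right (G + X) \<longrightarrow> wins_first Right (H + X)) \<and>
        (wins_first Left (H + X) \<longrightarrow> wins_first Left (G + X))" for X
  proof (induction "size X" arbitrary: X rule: less_induct)
    case less
    have "wins_first Right (H + X)" if "wins_first Right (G + X)"
    proof -
      from that consider "right_opts G = {||}" "right_opts X = {||}"
        | G' where "G' |\<in>| right_opts G" "\<not> wins_first Left (G' + X)"
        | X' where "X' |\<in>| right_opts X" "\<not> wins_first Left (G + X')"
        by (subst (asm) wins_first_Right) (auto simp: right_opts_plus)
      then show ?thesis
      proof cases
        case 1
        then show ?thesis using zero by (subst wins_first_Right) (simp add: right_opts_plus)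
      next
        case 2
        with opt obtain H' where "H' |\<in>| right_opts H" "misere_ge G' H'" by blast
        with 2 show ?thesis
          by (subst wins_first_Right) (auto simp: right_opts_plus misere_ge_iff_wins_first)
      next
        case 3
        with less size_right_option have "\<not> wins_first Left (H + X')" by blast
        with 3 show ?thesis by (subst wins_first_Right) (auto simp: right_opts_plus)
      qed
    qed
    moreover have "wins_first Left (G + X)" if "wins_first Left (H + X)"
      using that less size_left_option assms(1,2)
      by (subst (asm) wins_first_Left, subst wins_first_Left) (auto simp: left_opts_plus)
    ultimately show ?case by blast
  qed
  then show ?thesis by (simp add: misere_ge_iff_wins_first)
qed

lemma misere_ge_dead_end_zero_iff:
  assumes "left_dead_end G" "left_dead_end H" "misere_ge G H"
  shows "right_opts G = {||} \<longleftrightarrow> right_opts H = {||}"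
proof
  assume "right_opts G = {||}"
  then have "wins_first Right (G + 0)"
    by (subst wins_first_Right) (simp add: right_opts_plus)
  then have "wins_first Right (0 + H)"
    using assms(3) unfolding misere_ge_iff_wins_first by (metis game_plus_commute)
  then show "right_opts H = {||}"
    using assms(2) left_dead_end_right_option wins_first_Left_dead_end
    by (subst (asm) wins_first_Right) auto
next
  assume H: "right_opts H = {||}"
  show "right_opts G = {||}"
  proof (rule ccontr)
    assume "right_opts G \<noteq> {||}"
    then obtain G' where G': "G' |\<in>| right_opts G" by blast
    then have d: "left_dead_end G'" using assms(1) left_dead_end_right_option by blast
    \<comment> \<open>After Right's move to \<open>G'\<close>, Left must enter an integer too long
      for \<open>G'\<close>. If \<open>H\<close> has no Right option, Right must instead turn
      \<open>X\<close> into \<open>bar_one\<close>, and Left wins for lack of a move.\<close>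
    define X where "X = Game {|left_int (size G')|} {|bar_one|}"
    have "\<not> wins_first Left (G' + X)"
      by (subst wins_first_Left)
        (simp add: X_def left_opts_plus left_dead_end_left_opts[OF d]
          wins_first_Right_plus_left_int[OF d])
    then have "wins_first Right (G + X)"
      using G' by (subst wins_first_Right) (auto simp: right_opts_plus)
    then have "wins_first Right (H + X)"
      using assms(3) by (simp add: misere_ge_iff_wins_first)
    moreover have "wins_first Left (H + bar_one)"
      using assms(2) by (intro wins_first_Left_dead_end left_dead_end_plus left_dead_end_bar_one)
    ultimately show False
      by (subst (asm) wins_first_Right) (simp add: X_def right_opts_plus H)
  qed
qed

text \<open>A failure of the order may show only with Left to move. Separating games with Right to
  move are needed, since they will serve as positions just after a Left move.\<close>

lemma separate_Right_moving_first:
  assumes "left_dead_end G" "left_dead_end H" "\<not> misere_ge G H"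
  shows "\<exists>Y. wins_first Right (G + Y) \<and> \<not> wins_first Right (H + Y)"
proof -
  obtain X where "wins_first Right (G + X) \<and> \<not> wins_first Right (H + X) \<or>
      wins_first Left (H + X) \<and> \<not> wins_first Left (G + X)"
    using assms(3) misere_ge_iff_wins_first by blast
  then show ?thesis
  proof
    assume X: "wins_first Left (H + X) \<and> \<not> wins_first Left (G + X)"
    \<comment> \<open>Right's intended move is to \<open>X\<close>; after any other move Left answers with \<open>bar_one\<close>.\<close>
    define Y where "Y = Game {|bar_one|} {|X|}"
    have "wins_first Right (G + Y)"
      using X by (subst wins_first_Right) (auto simp: Y_def right_opts_plus)
    moreover have "wins_first Left (H' + Y)" if "H' |\<in>| right_opts H" for H'
      using not_wins_first_Right_plus_bar_one left_dead_end_right_option[OF assms(2) that]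
      by (subst wins_first_Left) (auto simp: Y_def left_opts_plus)
    then have "\<not> wins_first Right (H + Y)"
      using X by (subst wins_first_Right) (auto simp: Y_def right_opts_plus)
    ultimately show ?thesis by blast
  qed blast
qed

lemma misere_ge_dead_end_option:
  assumes "left_dead_end G" "left_dead_end H" "misere_ge G H" "G' |\<in>| right_opts G"
  shows "\<exists>H'. H' |\<in>| right_opts H \<and> misere_ge G' H'"
proof (rule ccontr)
  assume "\<not> ?thesis"
  then have no: "\<not> misere_ge G' H'" if "H' |\<in>| right_opts H" for H' using that by blast
  have d: "left_dead_end G'" using assms left_dead_end_right_option by blast
  have "\<exists>Y. wins_first Right (G' + Y) \<and> \<not> wins_first Right (H' + Y)"
    if "H' |\<in>| right_opts H" for H'
    using separate_Right_moving_first[OF d _ no] that assms(2) left_dead_end_right_option by blast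
  then obtain Y where Y: "wins_first Right (G' + Y H') \<and> \<not> wins_first Right (H' + Y H')"
    if "H' |\<in>| right_opts H" for H'
    by metis
  \<comment> \<open>This ensures that Left has a move in \<open>G' + X\<close> and Right has one in
    \<open>H + X\<close>; a player without one would win at once.\<close>
  have H: "right_opts H \<noteq> {||}"
    using misere_ge_dead_end_zero_iff[OF assms(1-3)] assms(4) by auto
  \<comment> \<open>\<open>X\<close> offers Left one separating game per option of \<open>H\<close>.
    At \<open>G'\<close> each of them loses for Left, but Right's forced move from \<open>H\<close>
    to some \<open>H'\<close> lets Left choose the matching \<open>Y H'\<close>.\<close>
  define X where "X = Game (Y |`| right_opts H) {||}"
  have "\<not> wins_first Left (G' + X)"
    using Y H by (subst wins_first_Left) (auto simp: X_def left_opts_plus left_dead_end_left_opts[OF d])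
  then have "wins_first Right (G + X)"
    using assms(4) by (subst wins_first_Right) (auto simp: right_opts_plus)
  then have "wins_first Right (H + X)"
    using assms(3) by (simp add: misere_ge_iff_wins_first)
  then obtain H' where H': "H' |\<in>| right_opts H" "\<not> wins_first Left (H' + X)"
    using H by (subst (asm) wins_first_Right) (auto simp: X_def right_opts_plus)
  have "H' + Y H' |\<in>| left_opts (H' + X)"
    using H'(1) by (auto simp: X_def left_opts_plus)
  with Y[OF H'(1)] H'(2) show False
    using wins_first_Left by blast
qed

section \<open>Cancellation\<close>

text \<open>The possible lengths of maximal runs of Right moves. The least length is the invariant
  behind cancellation.\<close>

fun ends_in :: "nat \<Rightarrow> game \<Rightarrow> bool" where
  "ends_in 0 G \<longleftrightarrow> right_opts G = {||}"
| "ends_in (Suc n) G \<longleftrightarrow> (\<exists>G'. G' |\<in>| right_opts G \<and> ends_in n G')"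

lemma ex_ends_in: "\<exists>n. ends_in n G"
proof (induction "size G" arbitrary: G rule: less_induct)
  case less
  show ?case
  proof (cases "right_opts G = {||}")
    case True
    then have "ends_in 0 G" by simp
    then show ?thesis by blast
  next
    case False
    then obtain G' where G': "G' |\<in>| right_opts G" by blast
    with less size_right_option obtain n where "ends_in n G'" by blast
    with G' have "ends_in (Suc n) G" by auto
    then show ?thesis by blast
  qed
qed

text \<open>A run in \<open>G\<close> is shadowed option by option in \<open>H\<close>, and both
  become zero at the same moment.\<close>

lemma ends_in_mono:
  "left_dead_end G \<Longrightarrow> left_dead_end H \<Longrightarrow> misere_ge G H \<Longrightarrow> ends_in n G \<Longrightarrow> ends_in n H"
proof (induction n arbitrary: G H)
  case 0
  then show ?case using misere_ge_dead_end_zero_iff by simp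
next
  case (Suc n)
  then show ?case
    using misere_ge_dead_end_option left_dead_end_right_option by (metis ends_in.simps(2))
qed

lemma ends_in_plusD: "ends_in n (G + H) \<Longrightarrow> \<exists>i j. n = i + j \<and> ends_in i G \<and> ends_in j H"
proof (induction n arbitrary: G H)
  case 0
  then show ?case by (auto simp: right_opts_plus)
next
  case (Suc n)
  then consider G' where "G' |\<in>| right_opts G" "ends_in n (G' + H)"
    | H' where "H' |\<in>| right_opts H" "ends_in n (G + H')"
    by (auto simp: right_opts_plus)
  then show ?case
  proof cases
    case 1
    with Suc.IH obtain i j where "n = i + j" "ends_in i G'" "ends_in j H" by blast
    with 1 have "Suc n = Suc i + j \<and> ends_in (Suc i) G \<and> ends_in j H" by auto
    then show ?thesis by blast
  next
    case 2
    with Suc.IH obtain i j where "n = i + j" "ends_in i G" "ends_in j H'" by blast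
    with 2 have "Suc n = i + Suc j \<and> ends_in i G \<and> ends_in (Suc j) H" by auto
    then show ?thesis by blast
  qed
qed

text \<open>A shortest run of \<open>K\<close> has the length of some run of \<open>B + K\<close>.
  That length splits into one for \<open>B\<close> and one for \<open>K\<close>; the latter is
  already at least the minimum, so the former is 0.\<close>

lemma right_opts_empty_if_ge_plus:
  assumes "left_dead_end B" "left_dead_end K" "misere_ge K (B + K)"
  shows "right_opts B = {||}"
proof -
  define n where "n = (LEAST n. ends_in n K)"
  have "ends_in n K"
    unfolding n_def by (rule LeastI_ex) (rule ex_ends_in)
  then have "ends_in n (B + K)"
    using assms ends_in_mono left_dead_end_plus by blast
  then obtain i j where ij: "n = i + j" "ends_in i B" "ends_in j K"
    using ends_in_plusD by blast
  have "n \<le> j"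
    unfolding n_def by (rule Least_le) (rule ij(3))
  with ij show ?thesis by simp
qed

text \<open>When Left's reply to Right's move to \<open>A\<close> was made in the common summand, moving
  from \<open>K\<close> to \<open>L\<close>, Right copies it; this cannot go on forever, so Left eventually replies in \<open>B\<close>.\<close>

lemma ge_plus_option_reply:
  assumes "left_dead_end A" "left_dead_end B"
  shows "left_dead_end K \<Longrightarrow> L |\<in>| right_opts K \<Longrightarrow> misere_ge (A + K) (B + L) \<Longrightarrow>
    \<exists>B' M. B' |\<in>| right_opts B \<and> left_dead_end M \<and> misere_ge (A + M) (B' + M)"
proof (induction "size K" arbitrary: K L rule: less_induct)
  case less
  have L: "left_dead_end L" using less.prems left_dead_end_right_option by blast
  have "A + L |\<in>| right_opts (A + K)"
    using less.prems by (auto simp: right_opts_plus)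
  then obtain Z where "Z |\<in>| right_opts (B + L)" "misere_ge (A + L) Z"
    using misere_ge_dead_end_option less.prems assms L left_dead_end_plus by meson
  then consider B' where "B' |\<in>| right_opts B" "misere_ge (A + L) (B' + L)"
    | M where "M |\<in>| right_opts L" "misere_ge (A + L) (B + M)"
    by (auto simp: right_opts_plus)
  then show ?case
  proof cases
    case 1
    with L show ?thesis by blast
  next
    case 2
    with less.hyps[OF size_right_option[OF less.prems(2)] L] show ?thesis by blast
  qed
qed

text \<open>The induction keeps \<open>K\<close> arbitrary because
  \<open>ge_plus_option_reply\<close> returns a reply in \<open>B\<close> with a different common
  summand \<open>M\<close>. The case of zero \<open>A\<close> cannot come from options and uses run
  lengths.\<close>

lemma misere_ge_dead_end_cancel:
  "left_dead_end A \<Longrightarrow> left_dead_end B \<Longrightarrow> left_dead_end K \<Longrightarrow> misere_ge (A + K) (B + K) \<Longrightarrow>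
    misere_ge A B"
proof (induction "size A" arbitrary: A B K rule: less_induct)
  case less
  have opt: "\<exists>B'. B' |\<in>| right_opts B \<and> misere_ge A' B'" if A': "A' |\<in>| right_opts A" for A'
  proof -
    have dA': "left_dead_end A'" using A' less.prems left_dead_end_right_option by blast
    have "A' + K |\<in>| right_opts (A + K)" using A' by (auto simp: right_opts_plus)
    then obtain Z where "Z |\<in>| right_opts (B + K)" "misere_ge (A' + K) Z"
      using misere_ge_dead_end_option less.prems left_dead_end_plus by meson
    then consider B' where "B' |\<in>| right_opts B" "misere_ge (A' + K) (B' + K)"
      | L where "L |\<in>| right_opts K" "misere_ge (A' + K) (B + L)"
      by (auto simp: right_opts_plus)
    then obtain B' M where "B' |\<in>| right_opts B" "left_dead_end M" "misere_ge (A' + M) (B' + M)"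
      using ge_plus_option_reply[OF dA' less.prems(2,3)] less.prems(3) by cases blast+
    then show ?thesis
      using less.hyps[OF size_right_option[OF A'] dA'] less.prems(2) left_dead_end_right_option
      by blast
  qed
  have "right_opts B = {||}" if "right_opts A = {||}"
  proof -
    have "A = 0"
      using that less.prems by (intro game_eqI) (simp_all add: left_dead_end_left_opts)
    then show ?thesis using less.prems right_opts_empty_if_ge_plus by simp
  qed
  moreover have "right_opts A = {||}" if "right_opts B = {||}"
    using opt that by fastforce
  ultimately show ?case
    using less.prems opt by (intro misere_ge_left_endI) (auto simp: left_dead_end_left_opts)
qed

section \<open>Divisibility by \<open>bar_one\<close>\<close>

text \<open>By induction each Right option of \<open>bar_one + X'\<close> is at least
  \<open>X'\<close>, itself an option of \<open>X\<close>. Hence delaying the move in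
  \<open>bar_one\<close> never helps Right.\<close>

lemma bar_one_plus_option_ge:
  "left_dead_end X \<Longrightarrow> X' |\<in>| right_opts X \<Longrightarrow> misere_ge (bar_one + X') X"
proof (induction "size X" arbitrary: X X' rule: less_induct)
  case less
  have X': "left_dead_end X'" using less.prems left_dead_end_right_option by blast
  show ?case
  proof (rule misere_ge_left_endI)
    show "left_opts (bar_one + X') = {||}" "left_opts X = {||}"
      using X' less.prems by (simp_all add: left_opts_plus left_dead_end_left_opts)
    show "right_opts (bar_one + X') = {||} \<longleftrightarrow> right_opts X = {||}"
      using less.prems by (auto simp: right_opts_plus)
    fix Z assume "Z |\<in>| right_opts (bar_one + X')"
    then consider "Z = X'" | X'' where "X'' |\<in>| right_opts X'" "Z = bar_one + X''"
      by (auto simp: right_opts_plus)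
    then have "misere_ge Z X'"
      using less.hyps[OF size_right_option[OF less.prems(2)] X'] misere_ge_refl by cases auto
    then show "\<exists>H'. H' |\<in>| right_opts X \<and> misere_ge Z H'"
      using less.prems by blast
  qed
qed

lemma bar_one_plus_option_cases_ge:
  assumes "left_dead_end G" "Z |\<in>| right_opts (bar_one + G)"
  shows "misere_ge Z G"
  using assms bar_one_plus_option_ge misere_ge_refl by (auto simp: right_opts_plus)

lemma eq_bar_one_plus_least_option:
  assumes "left_dead_end H" "H' |\<in>| right_opts H"
    and "\<And>H''. H'' |\<in>| right_opts H \<Longrightarrow> misere_ge H'' H'"
  shows "H =\<^sub>m bar_one + H'"
proof -
  have H': "left_dead_end H'" using assms left_dead_end_right_option by blast
  have left: "left_opts H = {||}" "left_opts (bar_one + H') = {||}"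
    using assms(1) H' by (simp_all add: left_opts_plus left_dead_end_left_opts)
  have right: "right_opts H \<noteq> {||}" "H' |\<in>| right_opts (bar_one + H')"
    using assms(2) by (auto simp: right_opts_plus)
  have "misere_ge H (bar_one + H')"
    using left right assms(3) by (intro misere_ge_left_endI) auto
  moreover have "misere_ge (bar_one + H') H"
    using left right assms(2) bar_one_plus_option_cases_ge[OF H']
    by (intro misere_ge_left_endI) auto
  ultimately show ?thesis by (simp add: misere_eq_def)
qed

text \<open>Each \<open>H'' + K\<close> is at least some option of \<open>bar_one + G\<close>, hence
  at least \<open>G\<close>, hence at least \<open>H' + K\<close>. Cancelling \<open>K\<close> makes
  \<open>H'\<close> least among the options of \<open>H\<close>.\<close>

lemma eq_bar_one_plus_if_option_le:
  assumes "left_dead_end H" "left_dead_end K" "left_dead_end G"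
    and ge: "misere_ge (H + K) (bar_one + G)"
    and H': "H' |\<in>| right_opts H" "misere_ge G (H' + K)"
  shows "\<exists>X. left_dead_end X \<and> H =\<^sub>m bar_one + X"
proof -
  have dH': "left_dead_end H'" using assms(1) H'(1) left_dead_end_right_option by blast
  have "misere_ge H'' H'" if H'': "H'' |\<in>| right_opts H" for H''
  proof (rule misere_ge_dead_end_cancel)
    show "left_dead_end H''" "left_dead_end H'" "left_dead_end K"
      using assms(1,2) dH' H'' left_dead_end_right_option by blast+
    have "H'' + K |\<in>| right_opts (H + K)"
      using H'' by (auto simp: right_opts_plus)
    then obtain Z where "Z |\<in>| right_opts (bar_one + G)" "misere_ge (H'' + K) Z"
      using misere_ge_dead_end_option[OF _ _ ge] assms(1-3) left_dead_end_plus left_dead_end_bar_one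
      by blast
    then show "misere_ge (H'' + K) (H' + K)"
      using bar_one_plus_option_cases_ge[OF assms(3)] H'(2) misere_ge_trans by blast
  qed
  then show ?thesis
    using eq_bar_one_plus_least_option[OF assms(1) H'(1)] dH' by blast
qed

theorem mainTheorem8:
  fixes H K :: game
  assumes "left_dead_end H" and "left_dead_end K"
    and "\<exists>G. left_dead_end G \<and> bar_one + G =\<^sub>m H + K"
  shows "\<exists>X. left_dead_end X \<and> (H =\<^sub>m bar_one + X \<or> K =\<^sub>m bar_one + X)"
proof -
  obtain G where G: "left_dead_end G"
    and le: "misere_ge (bar_one + G) (H + K)" and ge: "misere_ge (H + K) (bar_one + G)"
    using assms(3) by (auto simp: misere_eq_def)
  \<comment> \<open>Playing \<open>bar_one\<close> leaves \<open>G\<close>. Whether the option of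
    \<open>H + K\<close> below it comes from \<open>H\<close> or from \<open>K\<close> decides which
    of the two is divisible.\<close>
  have "G |\<in>| right_opts (bar_one + G)"
    by (auto simp: right_opts_plus)
  then obtain Z where "Z |\<in>| right_opts (H + K)" "misere_ge G Z"
    using misere_ge_dead_end_option[OF _ _ le] assms(1,2) G left_dead_end_plus left_dead_end_bar_one
    by blast
  then consider H' where "H' |\<in>| right_opts H" "misere_ge G (H' + K)"
    | K' where "K' |\<in>| right_opts K" "misere_ge G (H + K')"
    by (auto simp: right_opts_plus)
  then show ?thesis
  proof cases
    case 1
    then show ?thesis
      using eq_bar_one_plus_if_option_le[OF assms(1,2) G ge] by blast
  next
    case 2
    then show ?thesis
      using eq_bar_one_plus_if_option_le[OF assms(2,1) G] ge by (metis game_plus_commute)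
  qed
qed

end
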